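(* Let $\phi$ be a Koopman eigenfunction of $\dot{x} = f(x)$, $\mathcal{K}^t \phi = e^{\lambda t}\phi$, with $\mathrm{Re}(\lambda) \ne 0$. For a point $x$ let $$M_x = \{ p : F^t(x) = p \text{ for some } t \in [-\infty, \infty] \},$$ and let $\mathrm{cl}(M_x)$ denote the closure of $M_x$. Suppose $\mathrm{cl}(M_x)$ is bounded and $\phi$ is continuous on $\mathrm{cl}(M_x)$. Then $\phi(y) = 0$ for all $y \in \mathrm{cl}(M_x)$.
   Context: Consider $\dot{x} = f(x)$, $x \in X \subset \mathbb{R}^d$, with $f : \mathbb{R}^d \to \mathbb{R}^d$ sufficiently smooth to guarantee existence and uniqueness of solutions. $F^t(x_0)$ denotes the flow, i.e. the solution at time $t$ starting from $x_0$ at time $0$ (also for negative $t$). $X$ is compact and forward invariant under $F^t$. The Koopman operator acts on observables $g : X \to \mathbb{C}$ by $\mathcal{K}^t g = g \circ F^t$. A function $\phi : X \to \mathbb{C}$ is a (Koopman) eigenfunction with eigenvalue $\lambda \in \mathbb{C}$ if $\mathcal{K}^t\phi = e^{\lambda t}\phi$ for all $t$, i.e. $\phi(F^t(x)) = e^{\lambda t}\phi(x)$, for both positive and negative $t$ along the trajectory. The set $M_x$ is the full (forward and backward) trajectory through $x$; the values $t = \pm\infty$ are understood as limits of $F^t(x)$, when these exist. The set $\mathrm{cl}(M_x)$ is understood to lie in the domain of $\phi$. *)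

theory Defs
  imports "HOL-Analysis.Analysis"
begin

text \<open>Initial value problem \<open>u' = f u\<close>, \<open>u 0 = x\<close> on an open interval around 0.\<close>

definition ivp_solution ::
  "('a::real_normed_vector \<Rightarrow> 'a) \<Rightarrow> 'a \<Rightarrow> real set \<Rightarrow> (real \<Rightarrow> 'a) \<Rightarrow> bool" where
  "ivp_solution f x I u \<longleftrightarrow>
     open I \<and> is_interval I \<and> 0 \<in> I \<and> u 0 = x \<and>
     (\<forall>t\<in>I. (u has_vector_derivative f (u t)) (at t))"

text \<open>The smoothness required of the vector field is only that it is continuous and that
  initial value problems have local solutions which are unique wherever they are defined
  (this holds, for instance, if \<open>f\<close> is locally Lipschitz). Completeness is not assumed.\<close>

definition well_posed :: "('a::real_normed_vector \<Rightarrow> 'a) \<Rightarrow> bool" where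
  "well_posed f \<longleftrightarrow>
     continuous_on UNIV f \<and>
     (\<forall>x. \<exists>I u. ivp_solution f x I u) \<and>
     (\<forall>x I u J v. ivp_solution f x I u \<longrightarrow> ivp_solution f x J v \<longrightarrow> (\<forall>t\<in>I \<inter> J. u t = v t))"

text \<open>Maximal interval of existence, and the flow \<open>F\<^sup>t x\<close>, which is meaningful for
  \<open>t\<close> in that interval (of both signs).\<close>

definition exist_ivl :: "('a::real_normed_vector \<Rightarrow> 'a) \<Rightarrow> 'a \<Rightarrow> real set" where
  "exist_ivl f x = \<Union> {I. \<exists>u. ivp_solution f x I u}"

definition flow :: "('a::real_normed_vector \<Rightarrow> 'a) \<Rightarrow> real \<Rightarrow> 'a \<Rightarrow> 'a" where
  "flow f t x = (THE y. \<exists>I u. ivp_solution f x I u \<and> t \<in> I \<and> u t = y)"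

lemma flow_eq:
  assumes "well_posed f" "ivp_solution f x I u" "t \<in> I"
  shows "flow f t x = u t"
  unfolding flow_def
proof (rule the_equality)
  fix y assume "\<exists>J v. ivp_solution f x J v \<and> t \<in> J \<and> v t = y"
  then show "y = u t" using assms unfolding well_posed_def by blast
qed (use assms in blast)

definition forward_invariant :: "('a::real_normed_vector \<Rightarrow> 'a) \<Rightarrow> 'a set \<Rightarrow> bool" where
  "forward_invariant f X \<longleftrightarrow> (\<forall>x\<in>X. \<forall>t\<in>exist_ivl f x. t \<ge> 0 \<longrightarrow> flow f t x \<in> X)"

definition koopman ::
  "('a::real_normed_vector \<Rightarrow> 'a) \<Rightarrow> real \<Rightarrow> ('a \<Rightarrow> complex) \<Rightarrow> 'a \<Rightarrow> complex" where
  "koopman f t g = (\<lambda>x. g (flow f t x))"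

text \<open>Only the values of \<open>\<phi>\<close> on its domain \<open>X\<close> matter. Time \<open>t\<close> may be negative;
  backward in time a trajectory may leave \<open>X\<close>, and no condition is imposed there.\<close>

definition koopman_eigenfunction ::
  "('a::real_normed_vector \<Rightarrow> 'a) \<Rightarrow> 'a set \<Rightarrow> complex \<Rightarrow> ('a \<Rightarrow> complex) \<Rightarrow> bool" where
  "koopman_eigenfunction f X \<mu> \<phi> \<longleftrightarrow>
     (\<forall>x\<in>X. \<forall>t\<in>exist_ivl f x. flow f t x \<in> X \<longrightarrow>
        koopman f t \<phi> x = exp (\<mu> * of_real t) * \<phi> x)"

text \<open>\<open>F\<^sup>t x = p\<close> for extended times \<open>t\<close>; at \<open>t = \<plusminus>\<infinity>\<close> it says that \<open>F\<^sup>s x\<close> is defined for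
  all \<open>s \<ge> 0\<close> (resp. \<open>s \<le> 0\<close>) and converges to \<open>p\<close>.\<close>

fun flow_reaches :: "('a::real_normed_vector \<Rightarrow> 'a) \<Rightarrow> 'a \<Rightarrow> ereal \<Rightarrow> 'a \<Rightarrow> bool" where
  "flow_reaches f x (ereal t) p \<longleftrightarrow> t \<in> exist_ivl f x \<and> flow f t x = p"
| "flow_reaches f x PInfty p \<longleftrightarrow>
     {0..} \<subseteq> exist_ivl f x \<and> ((\<lambda>s. flow f s x) \<longlongrightarrow> p) at_top"
| "flow_reaches f x MInfty p \<longleftrightarrow>
     {..0} \<subseteq> exist_ivl f x \<and> ((\<lambda>s. flow f s x) \<longlongrightarrow> p) at_bot"

definition full_trajectory :: "('a::real_normed_vector \<Rightarrow> 'a) \<Rightarrow> 'a \<Rightarrow> 'a set" where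
  "full_trajectory f x = {p. \<exists>t\<in>{-\<infinity>..\<infinity>}. flow_reaches f x t p}"

end

theory Submission imports Defs begin

text \<open>
  Along the orbit of \<open>x\<close> the eigenfunction is \<open>\<phi> (F\<^sup>t x) = exp (\<mu> t) \<phi> x\<close>. If \<open>t\<close> ranges over the
  whole real line and \<open>Re \<mu> \<noteq> 0\<close>, the modulus of the right-hand side is unbounded unless
  \<open>\<phi> x = 0\<close>. But \<open>\<phi>\<close> is continuous on a closed bounded set containing the orbit, so it is bounded
  there. Hence \<open>\<phi>\<close> vanishes on the orbit, and by continuity on its closure, which already contains
  the limits at \<open>t = \<plusminus>\<infinity>\<close>.

  What remains is that the trajectory exists for all times of both signs. This is the classical
  continuation principle (\<open>ivp_solution_continues\<close>): a bounded solution on an interval ending at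
  \<open>b\<close> is Lipschitz, so it has a limit at \<open>b\<close>, and a local solution started at that limit can be
  attached to it. The attached curve solves the equation also at the junction by
  \<open>vector_derivative_removable\<close>. Existence backward in time follows by reversing time,
  which replaces \<open>f\<close> by \<open>- f\<close>.
\<close>

section \<open>Maximal solutions\<close>

lemma well_posed_solution_unique:
  assumes "well_posed f" "ivp_solution f x I u" "ivp_solution f x J v" "t \<in> I" "t \<in> J"
  shows "u t = v t"
  using assms unfolding well_posed_def by blast

lemma ivp_solution_subset_exist_ivl: "ivp_solution f x I u \<Longrightarrow> I \<subseteq> exist_ivl f x"
  unfolding exist_ivl_def by blast

text \<open>Local solutions agree wherever two of them are defined, and their intervals share the point 0,
  so together they form one solution on an open interval.\<close>

lemma ivp_solution_exist_ivl:
  assumes "well_posed f"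
  shows "ivp_solution f x (exist_ivl f x) (\<lambda>t. flow f t x)"
proof -
  obtain I u where Iu: "ivp_solution f x I u"
    using assms unfolding well_posed_def by blast
  have "open (exist_ivl f x)"
    unfolding exist_ivl_def ivp_solution_def by auto
  moreover have "connected (exist_ivl f x)"
    unfolding exist_ivl_def
    by (rule connected_Union) (auto simp: ivp_solution_def is_interval_connected)
  moreover have "0 \<in> exist_ivl f x" "flow f 0 x = x"
    using ivp_solution_subset_exist_ivl[OF Iu] flow_eq[OF assms Iu, of 0] Iu
    by (auto simp: ivp_solution_def)
  moreover have "((\<lambda>t. flow f t x) has_vector_derivative f (flow f t x)) (at t)"
    if t: "t \<in> exist_ivl f x" for t
  proof -
    obtain J v where J: "ivp_solution f x J v" "t \<in> J"
      using t unfolding exist_ivl_def by blast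
    then have "(v has_vector_derivative f (v t)) (at t)" "open J"
      by (auto simp: ivp_solution_def)
    then have "((\<lambda>t. flow f t x) has_vector_derivative f (v t)) (at t)"
      by (rule has_vector_derivative_transform_within_open) (use flow_eq[OF assms J(1)] J(2) in auto)
    then show ?thesis
      by (simp only: flow_eq[OF assms J])
  qed
  ultimately show ?thesis
    by (simp add: ivp_solution_def is_interval_connected_1)
qed

section \<open>Continuation of bounded solutions\<close>

text \<open>By the fundamental theorem of calculus, \<open>w\<close> is the integral of \<open>w'\<close> as soon as it is an
  antiderivative off a finite set, and the integral of a continuous function is differentiable
  everywhere.\<close>

lemma vector_derivative_removable:
  fixes w w' :: "real \<Rightarrow> 'a::banach"
  assumes "finite S" "continuous_on {a..b} w" "continuous_on {a..b} w'"
    and deriv: "\<And>t. t \<in> {a<..<b} - S \<Longrightarrow> (w has_vector_derivative w' t) (at t)"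
    and t: "t \<in> {a<..<b}"
  shows "(w has_vector_derivative w' t) (at t)"
proof -
  have w: "w s = w a + integral {a..s} w'" if s: "s \<in> {a<..<b}" for s
  proof -
    have "(w' has_integral (w s - w a)) {a..s}"
      using s by (intro fundamental_theorem_of_calculus_interior_strong[OF assms(1)] deriv
          continuous_on_subset[OF assms(2)]) auto
    then show ?thesis by (simp add: integral_unique)
  qed
  have "((\<lambda>s. w a + integral {a..s} w') has_vector_derivative w' t) (at t within {a..b})"
    using integral_has_vector_derivative[OF assms(3), of t] t
    by (auto intro!: derivative_eq_intros)
  then have "((\<lambda>s. w a + integral {a..s} w') has_vector_derivative w' t) (at t)"
    using t by (simp add: at_within_Icc_at)
  then show ?thesis
    using w t by (rule_tac has_vector_derivative_transform_within_open[of _ _ _ "{a<..<b}"]) auto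
qed

text \<open>The speed is \<open>norm (f (u t))\<close>, and a continuous \<open>f\<close> is bounded on the closure of the range of
  \<open>u\<close>, which is compact because the dimension is finite.\<close>

lemma ivp_solution_lipschitz:
  fixes f :: "'a::euclidean_space \<Rightarrow> 'a"
  assumes "continuous_on UNIV f" "ivp_solution f x I u" "bounded (u ` I)" "S \<subseteq> I" "convex S"
  shows "\<exists>B. B-lipschitz_on S u"
proof -
  have "bounded (f ` closure (u ` I))"
    using assms(1,3)
    by (intro compact_imp_bounded compact_continuous_image) (auto intro: continuous_on_subset)
  then obtain B where B: "\<And>y. y \<in> closure (u ` I) \<Longrightarrow> norm (f y) \<le> B"
    by (auto simp: bounded_iff)
  have "0 \<in> I" using assms(2) by (simp add: ivp_solution_def)
  then have "0 \<le> B"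
    using B[of "u 0"] closure_subset[of "u ` I"] norm_ge_zero[of "f (u 0)"]
    by (meson image_eqI order_trans subsetD)
  have "B-lipschitz_on S u"
  proof (rule bounded_derivative_imp_lipschitz[OF _ \<open>convex S\<close> _ \<open>0 \<le> B\<close>])
    fix t assume "t \<in> S"
    then have "t \<in> I" using assms(4) by auto
    then show "(u has_derivative (\<lambda>h. h *\<^sub>R f (u t))) (at t within S)"
      using assms(2) has_vector_derivative_at_within
      unfolding ivp_solution_def has_vector_derivative_def by blast
    have "norm (f (u t)) \<le> B"
      using B \<open>t \<in> I\<close> closure_subset[of "u ` I"] by blast
    then show "onorm (\<lambda>h. h *\<^sub>R f (u t)) \<le> B"
      by (intro onorm_bound \<open>0 \<le> B\<close>) (simp add: mult_left_mono mult.commute[of B])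
  qed
  then show ?thesis ..
qed

text \<open>A Lipschitz solution extends continuously up to \<open>b\<close>. The local solution started at the value
  there is shifted in time by \<open>b\<close> and appended; the result is an initial value solution whose
  interval contains \<open>b\<close>.\<close>

lemma ivp_solution_continues:
  fixes f :: "'a::euclidean_space \<Rightarrow> 'a"
  assumes wp: "well_posed f" and sol: "ivp_solution f x I u" and bdd: "bounded (u ` I)"
    and b: "b > 0" "{0..<b} \<subseteq> I"
  shows "b \<in> exist_ivl f x"
proof -
  have contf: "continuous_on UNIV f" using wp by (simp add: well_posed_def)
  \<comment> \<open>The solution is needed on a neighbourhood of the initial time, hence the start at \<open>c < 0\<close>.\<close>
  obtain c where c: "c < 0" "{c..<b} \<subseteq> I"
  proof -
    have "open I" "0 \<in> I" using sol by (auto simp: ivp_solution_def)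
    then obtain e where e: "e > 0" "cball 0 e \<subseteq> I" using open_contains_cball by blast
    have "{-e..<b} \<subseteq> I"
    proof
      fix t assume "t \<in> {-e..<b}"
      then show "t \<in> I"
        using e b by (cases "t < 0") (auto simp: subset_iff dist_real_def)
    qed
    with e show ?thesis using that[of "-e"] by simp
  qed
  obtain B where "B-lipschitz_on {c..<b} u"
    using ivp_solution_lipschitz[OF contf sol bdd c(2)] by auto
  moreover have "closure {c..<b} = {c..b}" using b c by simp
  ultimately obtain g where g: "continuous_on {c..b} g" "\<And>t. t \<in> {c..<b} \<Longrightarrow> u t = g t"
    using uniformly_continuous_on_extension_on_closure
      [OF lipschitz_on_uniformly_continuous, of B "{c..<b}" u]
    by (metis uniformly_continuous_imp_continuous)
  obtain J v where v: "ivp_solution f (g b) J v"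
    using wp unfolding well_posed_def by blast
  then have v': "open J" "0 \<in> J" "v 0 = g b"
    "\<And>t. t \<in> J \<Longrightarrow> (v has_vector_derivative f (v t)) (at t)"
    by (auto simp: ivp_solution_def)
  then obtain e where e: "e > 0" "cball 0 e \<subseteq> J" using open_contains_cball by blast
  define w where "w t = (if t \<le> b then g t else v (t - b))" for t
  have v_deriv: "((\<lambda>t. v (t - b)) has_vector_derivative f (v (t - b))) (at t)"
    if "t \<in> {b..b + e}" for t
  proof -
    have "t - b \<in> J" using that e by (auto simp: subset_iff dist_real_def)
    then have "(v has_vector_derivative f (v (t - b))) (at (t - b))" by (rule v'(4))
    moreover have "((\<lambda>t. t - b) has_vector_derivative 1) (at t)"
      by (auto intro!: derivative_eq_intros)
    ultimately show ?thesis
      using vector_diff_chain_at[of "\<lambda>t. t - b" 1 t v] by (simp add: o_def)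
  qed
  have contw: "continuous_on {c..b + e} w"
  proof -
    have "continuous_on {b..b + e} (\<lambda>t. v (t - b))"
      using v_deriv by (meson continuous_at_imp_continuous_on has_vector_derivative_continuous)
    then have "continuous_on ({c..b} \<union> {b..b + e}) w"
      unfolding w_def using g(1) v'(3) by (intro continuous_on_cases) auto
    moreover have "{c..b} \<union> {b..b + e} = {c..b + e}" using b c e by auto
    ultimately show ?thesis by simp
  qed
  have deriv: "(w has_vector_derivative f (w t)) (at t)" if t: "t \<in> {c<..<b + e} - {b}" for t
  proof (cases "t < b")
    case True
    then have "(u has_vector_derivative f (u t)) (at t)"
      using t c sol by (auto simp: ivp_solution_def subset_iff)
    moreover have "u s = w s" if "s \<in> {c<..<b}" for s
      using that g(2)[of s] by (simp add: w_def)
    ultimately show ?thesis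
      using has_vector_derivative_transform_within_open[of u "f (u t)" t "{c<..<b}" w] t True
      by simp
  next
    case False
    then show ?thesis
      using has_vector_derivative_transform_within_open
        [of "\<lambda>t. v (t - b)" "f (w t)" t "{b<..}" w] v_deriv[of t] t
      by (simp add: w_def)
  qed
  have "(w has_vector_derivative f (w t)) (at t)" if "t \<in> {c<..<b + e}" for t
    by (rule vector_derivative_removable[of "{b}" c "b + e" w "\<lambda>t. f (w t)"])
      (use deriv contw contf that in \<open>auto intro: continuous_on_compose2\<close>)
  moreover have "w 0 = x"
    using g(2)[of 0] b c sol by (simp add: w_def ivp_solution_def)
  ultimately have "ivp_solution f x {c<..<b + e} w"
    using b c e by (simp add: ivp_solution_def)
  then show ?thesis
    using ivp_solution_subset_exist_ivl[of f x "{c<..<b + e}" w] b c e by auto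
qed

lemma bounded_flow_exists_forward:
  fixes f :: "'a::euclidean_space \<Rightarrow> 'a"
  assumes wp: "well_posed f" and bdd: "bounded ((\<lambda>t. flow f t x) ` exist_ivl f x)"
  shows "{0..} \<subseteq> exist_ivl f x"
proof (rule ccontr)
  let ?E = "exist_ivl f x"
  define N where "N = {0..} - ?E"
  assume "\<not> {0..} \<subseteq> ?E"
  then have N: "N \<noteq> {}" unfolding N_def by auto
  have E: "open ?E" "0 \<in> ?E"
    using ivp_solution_exist_ivl[OF wp, of x] by (auto simp: ivp_solution_def)
  \<comment> \<open>The first time at which the solution ceases to exist.\<close>
  define b where "b = Inf N"
  have below: "bdd_below N" unfolding N_def by (intro bdd_belowI[of _ 0]) auto
  have "closed N" unfolding N_def using E(1) by (intro closed_Diff) auto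
  then have bN: "b \<in> N" unfolding b_def using N below by (intro closed_contains_Inf)
  have "b \<noteq> 0" using bN E(2) unfolding N_def by auto
  then have "b > 0" using bN unfolding N_def by auto
  moreover have "{0..<b} \<subseteq> ?E"
  proof
    fix t assume t: "t \<in> {0..<b}"
    then have "t \<notin> N" using cInf_lower[OF _ below, of t] unfolding b_def by auto
    then show "t \<in> ?E" using t unfolding N_def by auto
  qed
  ultimately have "b \<in> ?E"
    using ivp_solution_continues[OF wp ivp_solution_exist_ivl[OF wp] bdd] by blast
  then show False using bN unfolding N_def by auto
qed

section \<open>Time reversal\<close>

lemma ivp_solution_reverse:
  assumes "ivp_solution f x I u"
  shows "ivp_solution (\<lambda>y. - f y) x (uminus ` I) (\<lambda>t. u (- t))"
proof -
  have "((\<lambda>t. u (- t)) has_vector_derivative - f (u s)) (at (- s))" if "s \<in> I" for s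
  proof -
    have "(u has_vector_derivative f (u s)) (at (- (- s)))"
      using that assms by (simp add: ivp_solution_def)
    moreover have "(uminus has_vector_derivative - 1) (at (- s))"
      by (auto intro!: derivative_eq_intros)
    ultimately show ?thesis
      using vector_diff_chain_at[of uminus "-1" "- s" u] by (simp add: o_def)
  qed
  moreover have "is_interval (uminus ` I)"
    using assms by (simp add: ivp_solution_def is_interval_connected_1 connected_continuous_image
        continuous_on_minus)
  ultimately show ?thesis
    using assms by (auto simp: ivp_solution_def open_negations)
qed

lemma ivp_solution_reverse_iff:
  "ivp_solution (\<lambda>y. - f y) x I u \<longleftrightarrow> ivp_solution f x (uminus ` I) (\<lambda>t. u (- t))"
  using ivp_solution_reverse[of "\<lambda>y. - f y" x I u]
    ivp_solution_reverse[of f x "uminus ` I" "\<lambda>t. u (- t)"]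
  by (auto simp: image_image)

lemma well_posed_reverse:
  assumes "well_posed f"
  shows "well_posed (\<lambda>y. - f y)"
  unfolding well_posed_def
proof (intro conjI allI impI ballI)
  show "continuous_on UNIV (\<lambda>y. - f y)"
    using assms by (auto simp: well_posed_def intro: continuous_on_minus)
  show "\<exists>I u. ivp_solution (\<lambda>y. - f y) x I u" for x
    using assms ivp_solution_reverse unfolding well_posed_def by blast
  fix x I u J v t
  assume "ivp_solution (\<lambda>y. - f y) x I u" "ivp_solution (\<lambda>y. - f y) x J v" "t \<in> I \<inter> J"
  then show "u t = v t"
    using well_posed_solution_unique[OF assms, of x "uminus ` I" "\<lambda>t. u (- t)"
        "uminus ` J" "\<lambda>t. v (- t)" "- t"]
    by (auto simp: ivp_solution_reverse_iff)
qed

lemma exist_ivl_reverse: "exist_ivl (\<lambda>y. - f y) x = uminus ` exist_ivl f x"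
proof -
  have *: "uminus ` exist_ivl g x \<subseteq> exist_ivl (\<lambda>y. - g y) x" for g :: "'a \<Rightarrow> 'a"
  proof
    fix t assume "t \<in> uminus ` exist_ivl g x"
    then obtain I u where "ivp_solution g x I u" "t \<in> uminus ` I"
      unfolding exist_ivl_def by auto
    then show "t \<in> exist_ivl (\<lambda>y. - g y) x"
      using ivp_solution_subset_exist_ivl[OF ivp_solution_reverse] by blast
  qed
  from *[of f] image_mono[OF *[of "\<lambda>y. - f y"], of uminus] show ?thesis
    by (auto simp: image_image)
qed

lemma flow_reverse:
  assumes "well_posed f" "t \<in> exist_ivl f x"
  shows "flow (\<lambda>y. - f y) (- t) x = flow f t x"
  using flow_eq[OF well_posed_reverse[OF assms(1)]
      ivp_solution_reverse[OF ivp_solution_exist_ivl[OF assms(1)]], of "- t" x]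
    assms(2) by simp

lemma bounded_flow_exists_globally:
  fixes f :: "'a::euclidean_space \<Rightarrow> 'a"
  assumes wp: "well_posed f" and bdd: "bounded ((\<lambda>t. flow f t x) ` exist_ivl f x)"
  shows "exist_ivl f x = UNIV"
proof -
  have "(\<lambda>t. flow (\<lambda>y. - f y) t x) ` exist_ivl (\<lambda>y. - f y) x = (\<lambda>t. flow f t x) ` exist_ivl f x"
    using flow_reverse[OF wp] by (auto simp: exist_ivl_reverse image_image)
  then have "{0..} \<subseteq> uminus ` exist_ivl f x"
    using bounded_flow_exists_forward[OF well_posed_reverse[OF wp], of x] bdd
    by (simp add: exist_ivl_reverse)
  then have backward: "- t \<in> exist_ivl f x" if "t \<ge> 0" for t
    using that by force
  have forward: "t \<in> exist_ivl f x" if "t \<ge> 0" for t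
    using bounded_flow_exists_forward[OF assms] that by auto
  have "t \<in> exist_ivl f x" for t
    using backward[of "- t"] forward[of t] by (cases "t \<ge> 0") auto
  then show ?thesis by auto
qed

section \<open>Eigenfunctions on bounded trajectories\<close>

lemma flow_in_full_trajectory: "t \<in> exist_ivl f x \<Longrightarrow> flow f t x \<in> full_trajectory f x"
  unfolding full_trajectory_def
  by (auto intro!: bexI[of _ "ereal t"])

text \<open>Limits at infinite times are limits of points of the orbit, so they do not enlarge the
  closure.\<close>

lemma full_trajectory_subset_closure_orbit:
  "full_trajectory f x \<subseteq> closure ((\<lambda>t. flow f t x) ` exist_ivl f x)"
proof
  fix p assume "p \<in> full_trajectory f x"
  then obtain t where "flow_reaches f x t p" unfolding full_trajectory_def by blast
  then show "p \<in> closure ((\<lambda>t. flow f t x) ` exist_ivl f x)"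
  proof (cases t)
    case (real r)
    with \<open>flow_reaches f x t p\<close> show ?thesis
      using closure_subset by fastforce
  next
    case PInf
    with \<open>flow_reaches f x t p\<close> have
      E: "{0..} \<subseteq> exist_ivl f x" and lim: "((\<lambda>s. flow f s x) \<longlongrightarrow> p) at_top"
      by (simp_all flip: PInfty_eq_infinity)
    have "\<forall>\<^sub>F s in at_top. flow f s x \<in> closure ((\<lambda>t. flow f t x) ` exist_ivl f x)"
      using eventually_ge_at_top[of 0]
      by eventually_elim (use E closure_subset in fastforce)
    then show ?thesis
      by (rule Lim_in_closed_set[OF closed_closure _ _ lim]) simp
  next
    case MInf
    with \<open>flow_reaches f x t p\<close> have
      E: "{..0} \<subseteq> exist_ivl f x" and lim: "((\<lambda>s. flow f s x) \<longlongrightarrow> p) at_bot"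
      by (simp_all flip: MInfty_eq_minfinity)
    have "\<forall>\<^sub>F s in at_bot. flow f s x \<in> closure ((\<lambda>t. flow f t x) ` exist_ivl f x)"
      using eventually_le_at_bot[of 0]
      by eventually_elim (use E closure_subset in fastforce)
    then show ?thesis
      by (rule Lim_in_closed_set[OF closed_closure _ _ lim]) simp
  qed
qed

lemma closure_full_trajectory:
  "closure (full_trajectory f x) = closure ((\<lambda>t. flow f t x) ` exist_ivl f x)"
proof (rule antisym)
  show "closure (full_trajectory f x) \<subseteq> closure ((\<lambda>t. flow f t x) ` exist_ivl f x)"
    using full_trajectory_subset_closure_orbit by (intro closure_minimal) auto
  show "closure ((\<lambda>t. flow f t x) ` exist_ivl f x) \<subseteq> closure (full_trajectory f x)"
    using flow_in_full_trajectory by (intro closure_mono) auto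
qed

lemma bounded_exp_multiple_imp_zero:
  fixes \<mu> z :: complex
  assumes "Re \<mu> \<noteq> 0" and bound: "\<And>t. norm (exp (\<mu> * of_real t) * z) \<le> B"
  shows "z = 0"
proof (rule ccontr)
  assume "z \<noteq> 0"
  have "B \<ge> 0" using bound[of 0] norm_ge_zero order_trans by blast
  \<comment> \<open>The time at which the modulus equals \<open>B + 1\<close>; its sign depends on that of \<open>Re \<mu>\<close>.\<close>
  define t where "t = ln ((B + 1) / norm z) / Re \<mu>"
  have "Re (\<mu> * of_real t) = ln ((B + 1) / norm z)"
    using assms(1) by (simp add: t_def)
  then have "norm (exp (\<mu> * of_real t) * z) = B + 1"
    using \<open>z \<noteq> 0\<close> \<open>B \<ge> 0\<close> by (simp add: norm_mult)
  then show False using bound[of t] by simp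
qed

theorem mainTheorem6:
  fixes f :: "real ^ 'd \<Rightarrow> real ^ 'd"
    and X :: "(real ^ 'd) set"
    and \<phi> :: "real ^ 'd \<Rightarrow> complex"
    and \<mu> :: complex
    and x :: "real ^ 'd"
  assumes "well_posed f"
    and "compact X"
    and "forward_invariant f X"
    and "koopman_eigenfunction f X \<mu> \<phi>"
    and "Re \<mu> \<noteq> 0"
    and "closure (full_trajectory f x) \<subseteq> X"
    and "bounded (closure (full_trajectory f x))"
    and "continuous_on (closure (full_trajectory f x)) \<phi>"
  shows "\<forall>y\<in>closure (full_trajectory f x). \<phi> y = 0"
proof -
  let ?C = "closure (full_trajectory f x)"
  let ?orbit = "(\<lambda>t. flow f t x) ` exist_ivl f x"
  have C: "?C = closure ?orbit" by (rule closure_full_trajectory)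
  then have orbit: "?orbit \<subseteq> ?C" using closure_subset by simp
  have global: "exist_ivl f x = UNIV"
    using bounded_flow_exists_globally[OF assms(1)] bounded_subset[OF assms(7) orbit] by blast
  have "flow f 0 x = x"
    using ivp_solution_exist_ivl[OF assms(1), of x] by (simp add: ivp_solution_def)
  then have "x \<in> X"
    using orbit global assms(6) by (metis UNIV_I image_eqI subsetD)
  then have eigen: "\<phi> (flow f t x) = exp (\<mu> * of_real t) * \<phi> x" for t
    using assms(4,6) orbit global unfolding koopman_eigenfunction_def koopman_def by blast
  have "compact (\<phi> ` ?C)"
    using assms(7,8) by (intro compact_continuous_image) (auto simp: compact_eq_bounded_closed)
  then obtain B where B: "\<And>y. y \<in> ?C \<Longrightarrow> norm (\<phi> y) \<le> B"
    using compact_imp_bounded by (metis bounded_iff imageI)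
  have "\<phi> x = 0"
  proof (rule bounded_exp_multiple_imp_zero[OF assms(5)])
    show "norm (exp (\<mu> * of_real t) * \<phi> x) \<le> B" for t
      using B[of "flow f t x"] orbit global eigen[of t] by (simp add: image_subset_iff)
  qed
  then have zero: "\<And>y. y \<in> ?orbit \<Longrightarrow> \<phi> y = 0" using eigen by auto
  show ?thesis
    using continuous_constant_on_closure[of ?orbit \<phi> 0] assms(8) zero unfolding C by blast
qed

end
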